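(* Fix integers $a,b$ with $0\le a<b$ and set $c=a+b$. For $n\ge0$ let $p_n=(cn+b-a-1,\,2n)$ and $q_n=(cn+b-1,\,2n+1)$. Let $\mathscr{P}^{a,b}_n$ and $\mathscr{Q}^{a,b}_n$ be the sets of lattice paths from the origin to $p_n$ and $q_n$, respectively, lying weakly under $\partial_{a,b}$, and define $\mathscr{P}^{b,a}_n,\mathscr{Q}^{b,a}_n$ similarly with $\partial_{b,a}$. Then $$|\mathscr{Q}^{a,b}_n|=M_n,\qquad |\mathscr{Q}^{b,a}_n|=0,$$ $$|\mathscr{P}^{a,b}_n|=N_n+\frac12\sum_{i=0}^{n-1}M_iM_{n-1-i},\qquad |\mathscr{P}^{b,a}_n|=N_n-\frac12\sum_{i=0}^{n-1}M_iM_{n-1-i},$$ where $$M_n=\frac{b-a}{cn+b}\binom{(c+2)n+b}{2n+1},\qquad N_n=\frac{b-a}{cn+b-a}\binom{(c+2)n+b-a-1}{2n}.$$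
   Context: Lattice paths use unit steps $(0,1)$ and $(1,0)$. For nonnegative integers $u,v$, $\partial_{u,v}$ is the boundary curve $x=g_{u,v}(y)$, $y\ge0$, where $g_{u,v}$ is the continuous piecewise linear function with $g_{u,v}(0)=0$, slope $dx/dy=u$ on each interval $[2r,2r+1]$ and slope $v$ on each interval $[2r+1,2r+2]$, $r\ge0$ (i.e. the boundary of the periodic sequence $(u,v,u,v,\ldots)$). A lattice path from the origin lies weakly under $\partial_{u,v}$ if each of its lattice points $(x,y)$ satisfies $x\ge g_{u,v}(y)$. *)

theory Defs
  imports Complex_Main
begin

text \<open>Points of the integer lattice are pairs \<open>(x, y)\<close>. A lattice path is the nonempty list of
  the lattice points it visits, in order.\<close>

definition lattice_step :: "int \<times> int \<Rightarrow> int \<times> int \<Rightarrow> bool" where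
  "lattice_step p q \<longleftrightarrow> q = (fst p, snd p + 1) \<or> q = (fst p + 1, snd p)"

definition lattice_path :: "(int \<times> int) list \<Rightarrow> bool" where
  "lattice_path w \<longleftrightarrow> w \<noteq> [] \<and> successively lattice_step w"

text \<open>The piecewise linear function \<open>g\<close> whose graph \<open>x = g(y)\<close> is the boundary curve. With
  \<open>r = \<lfloor>y/2\<rfloor>\<close> and \<open>t = y - 2r\<close>, the first summand collects \<open>r\<close> full periods of \<open>g\<close>, and the
  other two are the increments of \<open>g\<close> over the parts of \<open>[2r, y]\<close> below and above \<open>2r + 1\<close>.
  Only arguments \<open>y \<ge> 0\<close> are relevant; see \<open>boundary_slopes\<close> and \<open>boundary_unique\<close> below.\<close>

definition boundary :: "nat \<Rightarrow> nat \<Rightarrow> real \<Rightarrow> real" where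
  "boundary u v y =
     (let r = real_of_int \<lfloor>y / 2\<rfloor>; t = y - 2 * r
      in r * (real u + real v) + real u * min t 1 + real v * max (t - 1) 0)"

definition paths_under :: "nat \<Rightarrow> nat \<Rightarrow> int \<times> int \<Rightarrow> (int \<times> int) list set" where
  "paths_under u v p =
     {w. lattice_path w \<and> hd w = (0, 0) \<and> last w = p \<and>
         (\<forall>(x, y) \<in> set w. real_of_int x \<ge> boundary u v (real_of_int y))}"

definition p_point :: "nat \<Rightarrow> nat \<Rightarrow> nat \<Rightarrow> int \<times> int" where
  "p_point a b n = ((int a + int b) * int n + int b - int a - 1, 2 * int n)"

definition q_point :: "nat \<Rightarrow> nat \<Rightarrow> nat \<Rightarrow> int \<times> int" where
  "q_point a b n = ((int a + int b) * int n + int b - 1, 2 * int n + 1)"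

definition M_num :: "nat \<Rightarrow> nat \<Rightarrow> nat \<Rightarrow> real" where
  "M_num a b n =
     (real b - real a) / (real (a + b) * real n + real b)
       * real (((a + b + 2) * n + b) choose (2 * n + 1))"

text \<open>The truncated subtraction below is exact for \<open>a < b\<close>.\<close>

definition N_num :: "nat \<Rightarrow> nat \<Rightarrow> nat \<Rightarrow> real" where
  "N_num a b n =
     (real b - real a) / (real (a + b) * real n + real b - real a)
       * real (((a + b + 2) * n + b - a - 1) choose (2 * n))"

lemma boundary_0: "boundary u v 0 = 0"
  by (simp add: boundary_def)

lemma boundary_even: "boundary u v (2 * real r) = real r * (real u + real v)"
  by (simp add: boundary_def)

lemma boundary_first:
  assumes "2 * real r \<le> y" "y \<le> 2 * real r + 1"
  shows "boundary u v y = real r * (real u + real v) + real u * (y - 2 * real r)"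
proof -
  have "\<lfloor>y / 2\<rfloor> = int r" using assms by (simp add: floor_eq_iff)
  thus ?thesis using assms by (simp add: boundary_def Let_def)
qed

lemma boundary_second:
  assumes "2 * real r + 1 \<le> y" "y \<le> 2 * real r + 2"
  shows "boundary u v y =
    real r * (real u + real v) + real u + real v * (y - (2 * real r + 1))"
proof (cases "y = 2 * real r + 2")
  case True
  hence y: "y = 2 * real (Suc r)" by simp
  show ?thesis unfolding y boundary_even by (simp add: algebra_simps)
next
  case False
  hence "\<lfloor>y / 2\<rfloor> = int r" using assms by (simp add: floor_eq_iff)
  thus ?thesis using assms by (simp add: boundary_def Let_def algebra_simps)
qed

lemma boundary_slopes:
  "\<And>y. 2 * real r \<le> y \<Longrightarrow> y \<le> 2 * real r + 1 \<Longrightarrow>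
     boundary u v y = boundary u v (2 * real r) + real u * (y - 2 * real r)"
  "\<And>y. 2 * real r + 1 \<le> y \<Longrightarrow> y \<le> 2 * real r + 2 \<Longrightarrow>
     boundary u v y = boundary u v (2 * real r + 1) + real v * (y - (2 * real r + 1))"
  using boundary_first[of r "2 * real r + 1" u v]
  by (simp_all add: boundary_first boundary_second boundary_even)

lemma boundary_unique:
  fixes g :: "real \<Rightarrow> real"
  assumes g0: "g 0 = 0"
    and g1: "\<And>r y. 2 * real r \<le> y \<Longrightarrow> y \<le> 2 * real r + 1 \<Longrightarrow>
               g y = g (2 * real r) + real u * (y - 2 * real r)"
    and g2: "\<And>r y. 2 * real r + 1 \<le> y \<Longrightarrow> y \<le> 2 * real r + 2 \<Longrightarrow>
               g y = g (2 * real r + 1) + real v * (y - (2 * real r + 1))"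
    and y: "y \<ge> 0"
  shows "g y = boundary u v y"
proof -
  have ev: "g (2 * real r) = boundary u v (2 * real r)" for r
  proof (induction r)
    case 0
    thus ?case by (simp add: g0 boundary_0)
  next
    case (Suc r)
    have "g (2 * real r + 2) = boundary u v (2 * real r + 2)"
      using g1[of r "2 * real r + 1"] g2[of r "2 * real r + 2"] Suc
        boundary_slopes(1)[of r "2 * real r + 1" u v] boundary_slopes(2)[of r "2 * real r + 2" u v]
      by simp
    thus ?case by (simp add: algebra_simps)
  qed
  define r where "r = nat \<lfloor>y / 2\<rfloor>"
  have r: "2 * real r \<le> y" "y \<le> 2 * real r + 2"
    using y unfolding r_def by linarith+
  show ?thesis
  proof (cases "y \<le> 2 * real r + 1")
    case True
    thus ?thesis using r g1[of r y] boundary_slopes(1)[of r y u v] ev[of r] by simp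
  next
    case False
    thus ?thesis
      using r g2[of r y] g1[of r "2 * real r + 1"] ev[of r]
        boundary_slopes(2)[of r y u v] boundary_slopes(1)[of r "2 * real r + 1" u v]
      by simp
  qed
qed

lemma lattice_path_bounds:
  assumes "successively lattice_step w" "w \<noteq> []"
  shows "set w \<subseteq> {fst (hd w)..fst (last w)} \<times> {snd (hd w)..snd (last w)} \<and>
    int (length w) = fst (last w) + snd (last w) - fst (hd w) - snd (hd w) + 1"
  using assms
proof (induction w rule: induct_list012)
  case (3 p q w)
  hence IH: "set (q # w) \<subseteq> {fst q..fst (last (q # w))} \<times> {snd q..snd (last (q # w))}"
      "int (length (q # w)) =
        fst (last (q # w)) + snd (last (q # w)) - fst q - snd q + 1"
    and st: "lattice_step p q" by auto
  have "q \<in> {fst q..fst (last (q # w))} \<times> {snd q..snd (last (q # w))}"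
    using IH(1) by (meson list.set_intros(1) subsetD)
  hence le: "fst q \<le> fst (last (q # w))" "snd q \<le> snd (last (q # w))"
    by (cases q, simp)+
  have pq: "fst p \<le> fst q" "snd p \<le> snd q" "fst q + snd q = fst p + snd p + 1"
    using st by (auto simp: lattice_step_def)
  have "p \<in> {fst p..fst (last (q # w))} \<times> {snd p..snd (last (q # w))}"
    using le pq by (cases p) auto
  moreover have "set (q # w) \<subseteq> {fst p..fst (last (q # w))} \<times> {snd p..snd (last (q # w))}"
    by (rule order.trans[OF IH(1)], rule Sigma_mono) (use pq in auto)
  ultimately show ?case using IH(2) pq(3) by simp
qed auto

lemma finite_paths_under: "finite (paths_under u v p)"
proof (rule finite_subset)
  show "paths_under u v p \<subseteq>
    {w. set w \<subseteq> {0..fst p} \<times> {0..snd p} \<and> length w = nat (fst p + snd p + 1)}"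
  proof
    fix w assume "w \<in> paths_under u v p"
    hence "w \<noteq> []" "successively lattice_step w" "hd w = (0, 0)" "last w = p"
      by (auto simp: paths_under_def lattice_path_def)
    with lattice_path_bounds[of w]
    show "w \<in> {w. set w \<subseteq> {0..fst p} \<times> {0..snd p} \<and> length w = nat (fst p + snd p + 1)}"
      by auto
  qed
  show "finite {w. set w \<subseteq> {0..fst p} \<times> {0..snd p} \<and> length w = nat (fst p + snd p + 1)}"
    by (rule finite_lists_length_eq) simp
qed

end

theory Submission
  imports Defs
begin

text \<open>Encode a path by its word of steps and measure the excess of its current \<open>x\<close>-coordinate over
  the boundary. Shifting the boundary along one up step exchanges \<open>\<partial>\<^bsub>a,b\<^esub>\<close> and
  \<open>\<partial>\<^bsub>b,a\<^esub>\<close>, so the excess along the periodic repetition of a word has periodic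
  increments, and the cycle lemma counts the starting points from which it stays positive. For
  \<open>p\<^sub>n\<close> (even height) one period is one copy of the word, which yields the sum of the two counts.
  For \<open>q\<^sub>n\<close> (odd height) one period is two copies, and only the starting points seeing
  \<open>\<partial>\<^bsub>a,b\<^esub>\<close> survive. Finally, a path to \<open>p\<^sub>n\<close> under \<open>\<partial>\<^bsub>a,b\<^esub>\<close> but not
  under \<open>\<partial>\<^bsub>b,a\<^esub>\<close> is last strictly above \<open>\<partial>\<^bsub>b,a\<^esub>\<close> at some \<open>q\<^sub>r\<close>; cutting it
  there gives a pair of paths to \<open>q\<^sub>r\<close> and \<open>q\<^bsub>n-1-r\<^esub>\<close> under \<open>\<partial>\<^bsub>a,b\<^esub>\<close>.\<close>

section \<open>The cycle lemma\<close>

text \<open>Let \<open>m k\<close> be the minimum of \<open>S\<close> over the window of length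
  \<open>T\<close> starting at \<open>k\<close>. Moving the window by one raises \<open>m\<close> by
  1 if \<open>k\<close> is counted and leaves it unchanged otherwise, while a whole period raises it
  by \<open>d\<close>. The hypothesis \<open>step\<close> caps each rise at 1; descents may be
  arbitrarily large.\<close>

lemma cycle_lemma:
  fixes S :: "nat \<Rightarrow> int"
  assumes T: "T > 0" and d: "d > 0"
    and period: "\<And>k. S (k + T) = S k + d"
    and step: "\<And>k. S (Suc k) \<le> S k + 1"
  shows "int (card {k. k < T \<and> (\<forall>j\<in>{1..T}. S k < S (k + j))}) = d"
proof -
  define m where "m k = Min (S ` {k..<k + T})" for k
  have m_le: "m k \<le> S j" if "k \<le> j" "j < k + T" for k j
    unfolding m_def using that by (intro Min_le) auto
  have m_in: "\<exists>j\<in>{k..<k + T}. m k = S j" for k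
  proof -
    have "m k \<in> S ` {k..<k + T}"
      unfolding m_def using T by (intro Min_in) auto
    thus ?thesis by auto
  qed
  have m_step: "m (Suc k) - m k = of_bool (\<forall>j\<in>{1..T}. S k < S (k + j))" for k
  proof -
    obtain i where i: "k \<le> i" "i < k + T" "m k = S i" using m_in[of k] by auto
    obtain i' where i': "Suc k \<le> i'" "i' < Suc k + T" "m (Suc k) = S i'"
      using m_in[of "Suc k"] by auto
    have Sk: "m k \<le> S k" using m_le[of k k] T by simp
    have Sk1: "m (Suc k) \<le> S (Suc k)" using m_le[of "Suc k" "Suc k"] T by simp
    show ?thesis
    proof (cases "\<forall>j\<in>{1..T}. S k < S (k + j)")
      \<comment> \<open>The old minimum is \<open>S k\<close>; the new one lies strictly above it,
        but not above \<open>S (Suc k) \<le> S k + 1\<close>.\<close>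
      case True
      have later: "S k < S j" if "k < j" "j \<le> k + T" for j
        using that bspec[OF True, of "j - k"] by fastforce
      have "m k = S k"
      proof (cases "i = k")
        case False
        thus ?thesis using later[of i] i Sk by simp
      qed (use i in simp)
      moreover have "S k < m (Suc k)" using later[of i'] i' by simp
      ultimately show ?thesis using True Sk1 step[of k] by simp
    next
      case False
      then obtain j where j: "1 \<le> j" "j \<le> T" "S (k + j) \<le> S k" by (auto simp: not_less)
      \<comment> \<open>Since \<open>S (k + T) = S k + d\<close> exceeds \<open>S k\<close>, the
        value at \<open>k + j\<close> stays in the shifted window. Hence dropping \<open>S k\<close>
        costs nothing, and the entering value is too large to lower the minimum.\<close>
      have "j \<noteq> T" using j period[of k] d by auto
      hence "m (Suc k) \<le> S k" using m_le[of "Suc k" "k + j"] j by simp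
      have "m (Suc k) \<le> m k"
        using \<open>m (Suc k) \<le> S k\<close> m_le[of "Suc k" i] i by (cases "i = k") auto
      moreover have "m k \<le> m (Suc k)"
      proof (cases "i' = k + T")
        case True
        thus ?thesis using i' period[of k] Sk d by simp
      next
        case False
        thus ?thesis using i' m_le[of k i'] by simp
      qed
      ultimately show ?thesis using False by simp
    qed
  qed
  have "S ` {T..<T + T} = (\<lambda>x. x + d) ` S ` {0..<T}"
  proof -
    have "{T..<T + T} = (\<lambda>k. k + T) ` {0..<T}" by simp
    hence "S ` {T..<T + T} = S ` (\<lambda>k. k + T) ` {0..<T}" by (rule arg_cong)
    thus ?thesis by (simp add: image_image period del: image_add_atLeastLessThan')
  qed
  hence "m T = m 0 + d"
    using T mono_Min_commute[of "\<lambda>x. x + d" "S ` {0..<T}"]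
    by (simp add: m_def mono_def)
  hence "d = (\<Sum>k<T. m (Suc k) - m k)" by (simp add: sum_lessThan_telescope)
  also have "\<dots> = (\<Sum>k<T. of_bool (\<forall>j\<in>{1..T}. S k < S (k + j)))"
    by (simp only: m_step)
  also have "\<dots> = int (card ({..<T} \<inter> {k. \<forall>j\<in>{1..T}. S k < S (k + j)}))"
    by (simp only: sum_of_bool_eq finite_lessThan)
  also have "{..<T} \<inter> {k. \<forall>j\<in>{1..T}. S k < S (k + j)} =
    {k. k < T \<and> (\<forall>j\<in>{1..T}. S k < S (k + j))}" by auto
  finally show ?thesis by simp
qed

lemma sum_lessThan_split:
  fixes f :: "nat \<Rightarrow> 'a::comm_monoid_add"
  shows "sum f {..<m + n} = sum f {..<m} + (\<Sum>k<n. f (m + k))"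
  by (induction n) (simp_all add: add.assoc)

section \<open>Words of steps\<close>

text \<open>In a word, \<open>True\<close> is an up step and \<open>False\<close> a right step.\<close>

definition words :: "nat \<Rightarrow> nat \<Rightarrow> bool list set" where
  "words X Y = {w. count_list w False = X \<and> count_list w True = Y}"

lemma length_bool_list: "length w = count_list w False + count_list w True"
  by (induction w) auto

lemma count_list_rotate [simp]: "count_list (rotate k w) x = count_list w x"
  by (metis count_list_append rotate_drop_take append_take_drop_id add.commute)

lemma finite_words [simp]: "finite (words X Y)"
proof (rule finite_subset)
  show "words X Y \<subseteq> {w. set w \<subseteq> UNIV \<and> length w = X + Y}"
    by (auto simp: words_def length_bool_list)
qed (rule finite_lists_length_eq, simp)

lemma card_words: "card (words X Y) = (X + Y) choose Y"
proof (induction "X + Y" arbitrary: X Y)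
  case 0
  have "words 0 0 = {[]}"
    by (auto simp: words_def) (metis (full_types) length_bool_list add_0 length_0_conv)
  thus ?case using 0 by simp
next
  case (Suc N)
  have split: "words X Y = (if X = 0 then {} else (#) False ` words (X - 1) Y)
      \<union> (if Y = 0 then {} else (#) True ` words X (Y - 1))" (is "_ = ?A \<union> ?B")
  proof (intro set_eqI)
    fix w show "w \<in> words X Y \<longleftrightarrow> w \<in> ?A \<union> ?B"
      using Suc(2) by (cases w; cases "hd w") (auto simp: words_def image_iff)
  qed
  have "card (words X Y) = card ?A + card ?B"
    unfolding split by (rule card_Un_disjoint) auto
  moreover have "card ?A = (if X = 0 then 0 else (X - 1 + Y) choose Y)"
    using Suc(1)[of "X - 1" Y] Suc(2) by (auto simp: card_image)
  moreover have "card ?B = (if Y = 0 then 0 else (X + (Y - 1)) choose (Y - 1))"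
    using Suc(1)[of X "Y - 1"] Suc(2) by (auto simp: card_image)
  ultimately show ?case using Suc(2) by (cases X; cases Y) auto
qed

lemma rotate_bij_words: "bij_betw (rotate k) (words X Y) (words X Y)"
proof -
  have inj: "inj_on (rotate k) (words X Y)"
  proof (rule inj_onI)
    fix v w :: "bool list"
    assume "v \<in> words X Y" "w \<in> words X Y" and eq: "rotate k v = rotate k w"
    hence "length v = length w" by (simp add: words_def length_bool_list)
    thus "v = w"
      using eq unfolding rotate_drop_take
      by (metis append_eq_append_conv append_take_drop_id length_drop)
  qed
  moreover have "rotate k ` words X Y \<subseteq> words X Y" by (auto simp: words_def)
  ultimately show ?thesis
    unfolding bij_betw_def by (simp add: endo_inj_surj)
qed

section \<open>Boundaries at integer heights and the excess of a word\<close>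

definition stair :: "nat \<Rightarrow> nat \<Rightarrow> nat \<Rightarrow> nat" where
  "stair u v h = (h div 2) * (u + v) + (if odd h then u else 0)"

text \<open>Starting from an odd height, the alternation of slopes is out of phase, which exchanges
  \<open>u\<close> and \<open>v\<close>.\<close>

lemma stair_add: "stair u v (h + k) = stair u v h + (if even h then stair u v k else stair v u k)"
  by (auto simp: stair_def elim!: evenE oddE; simp add: algebra_simps)

lemma boundary_stair: "boundary u v (real h) = real (stair u v h)"
proof (cases "even h")
  case True
  then obtain r where "h = 2 * r" by (elim evenE)
  thus ?thesis using boundary_even[of u v r] by (simp add: stair_def)
next
  case False
  then obtain r where "h = 2 * r + 1" by (elim oddE)
  thus ?thesis using boundary_first[of r "real h" u v] by (simp add: stair_def)
qed

definition excess :: "nat \<Rightarrow> nat \<Rightarrow> bool list \<Rightarrow> int" where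
  "excess u v w = int (count_list w False) - int (stair u v (count_list w True))"

lemma excess_append:
  "excess u v (w @ z) = excess u v w
    + (if even (count_list w True) then excess u v z else excess v u z)"
  by (simp add: excess_def stair_add)

lemma excess_Nil [simp]: "excess u v [] = 0"
  by (simp add: excess_def stair_def)

lemma excess_single: "excess u v [s] = (if s then - int u else 1)"
  by (simp add: excess_def stair_def)

text \<open>The two boundaries meet at every even height; at every odd height they are
  \<open>u\<close> versus \<open>v\<close> beyond the last meeting point.\<close>

lemma excess_swap:
  "excess v u w = excess u v w + (if odd (count_list w True) then int u - int v else 0)"
  by (simp add: excess_def stair_def add.commute)

definition words_under :: "nat \<Rightarrow> nat \<Rightarrow> nat \<Rightarrow> nat \<Rightarrow> bool list set" where
  "words_under u v X Y = {w \<in> words X Y. \<forall>i\<le>length w. 0 \<le> excess u v (take i w)}"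

section \<open>Words as lattice paths\<close>

fun trace :: "int \<times> int \<Rightarrow> bool list \<Rightarrow> (int \<times> int) list" where
  "trace p [] = [p]"
| "trace p (s # w) = p # trace (if s then (fst p, snd p + 1) else (fst p + 1, snd p)) w"

lemma trace_not_Nil [simp]: "trace p w \<noteq> []"
  by (cases w) auto

lemma hd_trace [simp]: "hd (trace p w) = p"
  by (cases w) auto

lemma last_trace:
  "last (trace p w) = (fst p + int (count_list w False), snd p + int (count_list w True))"
  by (induction w arbitrary: p) auto

lemma successively_trace: "successively lattice_step (trace p w)"
  by (induction w arbitrary: p) (auto simp: successively_Cons lattice_step_def)

lemma set_trace:
  "set (trace p w) = (\<lambda>i. (fst p + int (count_list (take i w) False),
                            snd p + int (count_list (take i w) True))) ` {..length w}"
proof (induction w arbitrary: p)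
  case (Cons s w)
  have "{..length (s # w)} = insert 0 (Suc ` {..length w})"
    by (simp add: atMost_Suc_eq_insert_0)
  thus ?case
    by (auto simp: Cons.IH image_image)
qed simp

lemma inj_trace: "trace p w = trace p z \<Longrightarrow> w = z"
proof (induction w arbitrary: p z)
  case Nil
  thus ?case by (cases z) (auto dest: sym simp del: if_split)
next
  case (Cons s w)
  then obtain s' z' where z: "z = s' # z'" by (cases z) auto
  have eq: "trace (if s then (fst p, snd p + 1) else (fst p + 1, snd p)) w =
    trace (if s' then (fst p, snd p + 1) else (fst p + 1, snd p)) z'"
    using Cons.prems z by simp
  have "s = s'" using arg_cong[OF eq, of hd] by (auto split: if_splits)
  thus ?case using eq Cons.IH z by simp
qed

lemma lattice_path_trace:
  "successively lattice_step w \<Longrightarrow> w \<noteq> [] \<Longrightarrow> \<exists>z. w = trace (hd w) z"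
proof (induction w rule: induct_list012)
  case (2 p)
  show ?case by (rule exI[of _ "[]"]) simp
next
  case (3 p q w)
  then obtain z where z: "q # w = trace q z" by auto
  from 3 have "lattice_step p q" by simp
  then consider "q = (fst p, snd p + 1)" | "q = (fst p + 1, snd p)"
    unfolding lattice_step_def by blast
  thus ?case
  proof cases
    case 1
    thus ?thesis using z by (intro exI[of _ "True # z"]) simp
  next
    case 2
    thus ?thesis using z by (intro exI[of _ "False # z"]) simp
  qed
qed simp

text \<open>Tracing a word from the origin identifies words with lattice paths. Only integer heights
  are visited, where \<open>stair\<close> gives the boundary, so the condition on a path becomes
  nonnegative excess of all prefixes.\<close>

lemma card_paths_under:
  "card (paths_under u v (int X, int Y)) = card (words_under u v X Y)"
proof -
  have under_iff: "(\<forall>(x, y)\<in>set (trace (0, 0) w). boundary u v (real_of_int y) \<le> real_of_int x)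
      \<longleftrightarrow> (\<forall>i\<le>length w. 0 \<le> excess u v (take i w))" for w
    by (auto simp: set_trace boundary_stair excess_def)
  have "paths_under u v (int X, int Y) = trace (0, 0) ` words_under u v X Y" (is "?A = ?B")
  proof (intro equalityI subsetI)
    fix w assume w: "w \<in> ?A"
    then obtain z where z: "w = trace (0, 0) z"
      using lattice_path_trace[of w] by (auto simp: paths_under_def lattice_path_def)
    have "z \<in> words_under u v X Y"
      using w under_iff[of z]
      by (auto simp: z paths_under_def words_under_def words_def last_trace)
    thus "w \<in> ?B" using z by blast
  next
    fix w assume "w \<in> ?B"
    then obtain z where z: "w = trace (0, 0) z" "z \<in> words_under u v X Y" by blast
    thus "w \<in> ?A"
      using under_iff[of z]
      by (auto simp: paths_under_def words_under_def words_def last_trace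
          lattice_path_def successively_trace)
  qed
  moreover have "inj_on (trace (0, 0)) (words_under u v X Y)"
    by (rule inj_onI) (rule inj_trace)
  ultimately show ?thesis by (simp add: card_image)
qed

section \<open>Rotating words\<close>

definition dominating :: "nat \<Rightarrow> nat \<Rightarrow> bool list \<Rightarrow> bool" where
  "dominating u v w \<longleftrightarrow> (\<forall>i\<in>{1..length w}. 0 < excess u v (take i w))"

text \<open>A leading right step raises the excess of every later prefix by one and so turns the
  weak condition into the strict one of the cycle lemma. Conversely, a dominating word cannot begin
  with an up step, whose excess is \<open>- u\<close>.\<close>

lemma dominating_words:
  "{w \<in> words (Suc X) Y. dominating u v w} = (#) False ` words_under u v X Y"
proof (intro set_eqI iffI)
  fix w assume "w \<in> {w \<in> words (Suc X) Y. dominating u v w}"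
  hence w: "w \<in> words (Suc X) Y" and dom: "\<And>i. 1 \<le> i \<Longrightarrow> i \<le> length w \<Longrightarrow> 0 < excess u v (take i w)"
    by (auto simp: dominating_def)
  from w obtain s z where sz: "w = s # z" by (cases w) (auto simp: words_def)
  have right: "\<not> s" using dom[of 1] by (auto simp: sz excess_single)
  have "0 \<le> excess u v (take i z)" if "i \<le> length z" for i
    using dom[of "Suc i"] that right excess_append[of u v "[False]" "take i z"]
    by (simp add: sz excess_single)
  thus "w \<in> (#) False ` words_under u v X Y"
    using w right by (auto simp: sz words_def words_under_def)
next
  fix w assume "w \<in> (#) False ` words_under u v X Y"
  then obtain z where z: "w = False # z" "z \<in> words X Y"
    "\<And>i. i \<le> length z \<Longrightarrow> 0 \<le> excess u v (take i z)"
    by (auto simp: words_under_def)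
  have "0 < excess u v (take i w)" if "1 \<le> i" "i \<le> length w" for i
    using z(3)[of "i - 1"] that excess_append[of u v "[False]" "take (i - 1) z"]
    by (cases i) (auto simp: z(1) excess_single)
  thus "w \<in> {w \<in> words (Suc X) Y. dominating u v w}"
    using z by (auto simp: words_def dominating_def)
qed

lemma card_dominating:
  "card {w \<in> words (Suc X) Y. dominating u v w} = card (words_under u v X Y)"
  by (simp add: dominating_words card_image)

section \<open>The infinite periodic repetition of a word\<close>

definition cyclic_prefix :: "bool list \<Rightarrow> nat \<Rightarrow> bool list" where
  "cyclic_prefix w i = map (\<lambda>j. w ! (j mod length w)) [0..<i]"

lemma cyclic_prefix_take: "i \<le> length w \<Longrightarrow> cyclic_prefix w i = take i w"
  by (rule nth_equalityI) (auto simp: cyclic_prefix_def)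

lemma cyclic_prefix_add:
  assumes "w \<noteq> []"
  shows "cyclic_prefix w (k + j) = cyclic_prefix w k @ cyclic_prefix (rotate k w) j"
proof (rule nth_equalityI)
  fix i assume "i < length (cyclic_prefix w (k + j))"
  hence i: "i < k + j" by (simp add: cyclic_prefix_def)
  have "rotate k w ! ((i - k) mod length w) = w ! (i mod length w)" if "\<not> i < k"
    using that assms by (simp add: nth_rotate mod_add_right_eq)
  thus "cyclic_prefix w (k + j) ! i = (cyclic_prefix w k @ cyclic_prefix (rotate k w) j) ! i"
    using i by (auto simp: cyclic_prefix_def nth_append)
qed (simp add: cyclic_prefix_def)

lemma cyclic_prefix_length_add:
  "w \<noteq> [] \<Longrightarrow> cyclic_prefix w (length w + j) = w @ cyclic_prefix w j"
  by (simp add: cyclic_prefix_add cyclic_prefix_take)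

lemma excess_cyclic_prefix_Suc:
  assumes "w \<noteq> []"
  shows "excess u v (cyclic_prefix w (Suc k)) \<le> excess u v (cyclic_prefix w k) + 1"
proof -
  have "cyclic_prefix w (Suc k) = cyclic_prefix w k @ [w ! (k mod length w)]"
    by (simp add: cyclic_prefix_def)
  thus ?thesis by (simp add: excess_append excess_single)
qed

text \<open>From position \<open>k\<close> on, the increments are excesses of the rotated word,
  against the boundary selected by the parity of the height reached at \<open>k\<close>. Thus the
  starting points counted by the cycle lemma translate into dominating rotations.\<close>

lemma excess_cyclic_prefix_add:
  assumes "w \<noteq> []"
  shows "excess u v (cyclic_prefix w (k + j)) = excess u v (cyclic_prefix w k)
    + (if even (count_list (cyclic_prefix w k) True)
       then excess u v (cyclic_prefix (rotate k w) j)
       else excess v u (cyclic_prefix (rotate k w) j))"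
  using assms by (simp add: cyclic_prefix_add excess_append)

text \<open>Rotation by a fixed \<open>k\<close> permutes \<open>words X Y\<close>, so every
  \<open>k\<close> contributes the same amount.\<close>

lemma sum_rotations_words:
  "(\<Sum>w\<in>words X Y. \<Sum>k<X + Y. of_bool (P (rotate k w)) :: nat)
    = (X + Y) * card {w \<in> words X Y. P w}"
proof -
  have "(\<Sum>w\<in>words X Y. \<Sum>k<X + Y. of_bool (P (rotate k w)) :: nat)
      = (\<Sum>k<X + Y. \<Sum>w\<in>words X Y. of_bool (P (rotate k w)))"
    by (rule sum.swap)
  also have "\<dots> = (\<Sum>k<X + Y. \<Sum>w\<in>words X Y. of_bool (P w))"
    by (intro sum.cong refl sum.reindex_bij_betw rotate_bij_words)
  also have "\<dots> = (X + Y) * card {w \<in> words X Y. P w}"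
    by (simp add: Collect_conj_eq)
  finally show ?thesis .
qed

text \<open>For even \<open>Y\<close> one copy of \<open>w\<close> restores the phase of the
  boundary and adds \<open>d\<close> to the excess. The cycle lemma is applied to each of the two
  boundaries and gives \<open>d\<close> both times. One run alone mixes rotations tested against
  different boundaries, so only the sum comes out.\<close>

lemma rotations_even:
  assumes w: "w \<in> words X Y" and Y: "even Y" and X: "X = stair u v Y + d" and d: "d > 0"
  shows "(\<Sum>k<X + Y. of_bool (dominating u v (rotate k w)) :: nat)
       + (\<Sum>k<X + Y. of_bool (dominating v u (rotate k w))) = 2 * d"
proof -
  have len: "length w = X + Y" and ne: "w \<noteq> []"
    using w d X by (auto simp: words_def length_bool_list)
  have counts: "count_list w False = X" "count_list w True = Y" using w by (auto simp: words_def)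
  have stair_sym: "stair v u Y = stair u v Y" using Y by (simp add: stair_def add.commute)
  \<comment> \<open>The label tells whether a start at \<open>k\<close> sees the boundary in its
    original or in its exchanged form.\<close>
  define lab where "lab k \<longleftrightarrow> even (count_list (cyclic_prefix w k) True)" for k
  have one: "(\<Sum>k<X + Y. of_bool (if lab k then dominating u' v' (rotate k w)
      else dominating v' u' (rotate k w))) = d" (is "?s = d")
    if st: "stair u' v' Y = stair u v Y" for u' v'
  proof -
    define S where "S k = excess u' v' (cyclic_prefix w k)" for k
    have good: "(\<forall>j\<in>{1..X + Y}. S k < S (k + j)) \<longleftrightarrow>
      (if lab k then dominating u' v' (rotate k w) else dominating v' u' (rotate k w))" for k
      unfolding S_def dominating_def lab_def
      by (auto simp: excess_cyclic_prefix_add[OF ne] cyclic_prefix_take len)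
    have per: "S (k + (X + Y)) = S k + int d" for k
      using cyclic_prefix_length_add[OF ne, of k] Y st
      by (simp add: S_def len excess_append counts add.commute)
        (simp add: excess_def counts X)
    have "int (card {k. k < X + Y \<and> (\<forall>j\<in>{1..X + Y}. S k < S (k + j))}) = int d"
      by (rule cycle_lemma)
        (use d X per excess_cyclic_prefix_Suc[OF ne] in \<open>auto simp: S_def\<close>)
    moreover have "?s = card {k. k < X + Y \<and> (\<forall>j\<in>{1..X + Y}. S k < S (k + j))}"
      unfolding good by (simp add: Collect_conj_eq lessThan_def)
    ultimately show ?thesis by linarith
  qed
  \<comment> \<open>At each \<open>k\<close> the two runs test opposite boundaries, so together they
    test every rotation against both.\<close>
  have "2 * d = (\<Sum>k<X + Y. of_bool (if lab k then dominating u v (rotate k w)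
      else dominating v u (rotate k w)) + of_bool (if lab k then dominating v u (rotate k w)
      else dominating u v (rotate k w)))"
    using one[of u v] one[of v u] stair_sym by (simp add: sum.distrib)
  also have "\<dots> = (\<Sum>k<X + Y. of_bool (dominating u v (rotate k w))
      + of_bool (dominating v u (rotate k w)))"
    by (intro sum.cong) auto
  finally show ?thesis by (simp add: sum.distrib)
qed

text \<open>One copy of \<open>w\<close> exchanges the boundaries, so the period is two copies, with
  increment \<open>v - u\<close>. A start at an odd height sees \<open>(v, u)\<close>, against which
  a whole copy has excess 0, and fails. A start at an even height is good exactly if its rotation
  dominates \<open>(u, v)\<close>.\<close>

lemma rotations_odd:
  assumes w: "w \<in> words X Y" and Y: "odd Y" and X: "X = stair v u Y" and uv: "u < v"
  shows "(\<Sum>k<X + Y. of_bool (dominating u v (rotate k w)) :: nat) = v - u"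
proof -
  define L where "L = X + Y"
  have len: "length w = L" and ne: "w \<noteq> []" and L: "L > 0"
    using w Y by (auto simp: words_def length_bool_list L_def elim: oddE)
  have counts: "count_list w False = X" "count_list w True = Y" using w by (auto simp: words_def)
  have exw: "excess u v w' = int v - int u" "excess v u w' = 0" if "w' \<in> words X Y" for w'
    using that Y X uv by (auto simp: words_def excess_def stair_def)
  define S where "S k = excess u v (cyclic_prefix w k)" for k
  have double: "cyclic_prefix w (L + (L + k)) = w @ w @ cyclic_prefix w k" for k
    using cyclic_prefix_length_add[OF ne] len by simp
  have per: "S (k + 2 * L) = S k + int (v - u)" for k
  proof -
    have "S (k + 2 * L) = excess u v (w @ w @ cyclic_prefix w k)"
      using double[of k] by (simp add: S_def mult_2 add_ac)
    also have "\<dots> = excess u v w + (excess v u w + S k)"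
      using Y by (simp add: excess_append counts S_def)
    also have "\<dots> = S k + int (v - u)" using exw[OF w] uv by simp
    finally show ?thesis .
  qed
  define lab where "lab k \<longleftrightarrow> even (count_list (cyclic_prefix w k) True)" for k
  have good: "(\<forall>j\<in>{1..2 * L}. S k < S (k + j)) \<longleftrightarrow> lab k \<and> dominating u v (rotate k w)"
    (is "?l \<longleftrightarrow> ?r") for k
  proof
    assume l: ?l
    have z: "rotate k w \<in> words X Y" using counts by (simp add: words_def)
    \<comment> \<open>With an odd label, \<open>j = L\<close> would give
      \<open>S (k + L) = S k\<close>.\<close>
    have "lab k"
      using bspec[OF l, of L] L exw[OF z]
      by (auto simp: S_def excess_cyclic_prefix_add[OF ne] cyclic_prefix_take len lab_def
          split: if_splits)
    moreover have "dominating u v (rotate k w)"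
      unfolding dominating_def
    proof
      fix i assume "i \<in> {1..length (rotate k w)}"
      thus "0 < excess u v (take i (rotate k w))"
        using bspec[OF l, of i] \<open>lab k\<close>
        by (auto simp: S_def excess_cyclic_prefix_add[OF ne] cyclic_prefix_take len lab_def)
    qed
    ultimately show ?r ..
  next
    assume r: ?r
    define z where "z = rotate k w"
    have z: "z \<in> words X Y" "z \<noteq> []" "length z = L"
      using counts ne len by (simp_all add: z_def words_def)
    have pos: "0 < excess u v (take i z)" if "1 \<le> i" "i \<le> L" for i
      using r that z by (auto simp: dominating_def z_def[symmetric])
    have "0 < excess u v (cyclic_prefix z j)" if j: "1 \<le> j" "j \<le> 2 * L" for j
    proof (cases "j \<le> L")
      case True
      thus ?thesis using pos j z by (simp add: cyclic_prefix_take)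
    next
      case False
      define i where "i = j - L"
      have i: "j = L + i" "1 \<le> i" "i \<le> L" using False j by (auto simp: i_def)
      have "cyclic_prefix z j = z @ take i z"
        using cyclic_prefix_length_add[OF z(2), of i] z(3) i by (simp add: cyclic_prefix_take)
      \<comment> \<open>On the second copy the boundary is exchanged, at a cost of at most \<open>v - u\<close>, which is
        exactly the excess accumulated on the first copy.\<close>
      hence "excess u v (cyclic_prefix z j) = int v - int u + excess v u (take i z)"
        using z(1) Y exw(1)[OF z(1)] by (simp add: excess_append words_def)
      thus ?thesis using pos[OF i(2,3)] excess_swap[of v u "take i z"] uv
        by (simp split: if_splits)
    qed
    thus ?l using r by (auto simp: S_def excess_cyclic_prefix_add[OF ne] lab_def z_def)
  qed
  \<comment> \<open>Positions \<open>k\<close> and \<open>L + k\<close> share their rotation and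
    have opposite labels, so the double period counts each of the \<open>L\<close> rotations exactly
    once.\<close>
  have labL: "lab (L + k) \<longleftrightarrow> \<not> lab k" for k
    using cyclic_prefix_length_add[OF ne, of k] Y by (simp add: lab_def len counts)
  have rotL: "rotate (L + k) w = rotate k w" for k
    using len rotate_conv_mod[of "L + k" w] rotate_conv_mod[of k w] by simp
  have "int (card {k. k < 2 * L \<and> (\<forall>j\<in>{1..2 * L}. S k < S (k + j))}) = int (v - u)"
    by (rule cycle_lemma)
      (use L uv per excess_cyclic_prefix_Suc[OF ne] in \<open>auto simp: S_def\<close>)
  hence "v - u = card {k. k < 2 * L \<and> (lab k \<and> dominating u v (rotate k w))}"
    unfolding good by simp
  also have "\<dots> = (\<Sum>k<L + L. of_bool (lab k \<and> dominating u v (rotate k w)))"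
    by (simp add: Collect_conj_eq lessThan_def mult_2 Int_assoc)
  also have "\<dots> = (\<Sum>k<L. of_bool (lab k \<and> dominating u v (rotate k w)))
      + (\<Sum>k<L. of_bool (\<not> lab k \<and> dominating u v (rotate k w)))"
    by (simp only: sum_lessThan_split labL rotL)
  also have "\<dots> = (\<Sum>k<L. of_bool (dominating u v (rotate k w)))"
    unfolding sum.distrib[symmetric] by (intro sum.cong) auto
  finally show ?thesis by (simp add: L_def)
qed

section \<open>Counting words under the boundaries by double counting over rotations\<close>

lemma card_words_under_even:
  assumes "even Y" "Suc X = stair u v Y + d" "d > 0"
  shows "(Suc X + Y) * (card (words_under u v X Y) + card (words_under v u X Y))
    = 2 * d * ((Suc X + Y) choose Y)"
proof -
  \<comment> \<open>The words summed over have \<open>Suc X\<close> right steps because of the right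
    step prepended to obtain dominating words.\<close>
  have "(Suc X + Y) * (card (words_under u v X Y) + card (words_under v u X Y))
    = (\<Sum>w\<in>words (Suc X) Y. (\<Sum>k<Suc X + Y. of_bool (dominating u v (rotate k w)))
        + (\<Sum>k<Suc X + Y. of_bool (dominating v u (rotate k w))))"
    by (simp only: sum.distrib sum_rotations_words card_dominating distrib_left)
  also have "\<dots> = (\<Sum>w\<in>words (Suc X) Y. 2 * d)"
    by (intro sum.cong refl rotations_even assms)
  finally show ?thesis by (simp only: sum_constant card_words of_nat_id mult.commute)
qed

lemma card_words_under_odd:
  assumes "odd Y" "Suc X = stair v u Y" "u < v"
  shows "(Suc X + Y) * card (words_under u v X Y) = (v - u) * ((Suc X + Y) choose Y)"
proof -
  have "(Suc X + Y) * card (words_under u v X Y)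
    = (\<Sum>w\<in>words (Suc X) Y. (\<Sum>k<Suc X + Y. of_bool (dominating u v (rotate k w))))"
    by (simp only: sum_rotations_words card_dominating)
  also have "\<dots> = (\<Sum>w\<in>words (Suc X) Y. v - u)"
    by (intro sum.cong refl rotations_odd assms)
  finally show ?thesis by (simp only: sum_constant card_words of_nat_id mult.commute)
qed

lemma finite_words_under [simp]: "finite (words_under u v X Y)"
  by (simp add: words_under_def)

section \<open>Cutting at the last violation\<close>

lemma last_violation_unique:
  fixes i j :: nat
  assumes "P i" "\<And>k. i < k \<Longrightarrow> k \<le> N \<Longrightarrow> \<not> P k" "P j" "\<And>k. j < k \<Longrightarrow> k \<le> N \<Longrightarrow> \<not> P k"
    "i \<le> N" "j \<le> N"
  shows "i = j"
  using assms by (meson linorder_neqE_nat)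

context
  fixes a b n :: nat
  assumes ab: "a < b"
begin

abbreviation "P_words u v \<equiv> words_under u v ((a + b) * n + b - a - 1) (2 * n)"
abbreviation "Q_words r \<equiv> words_under a b ((a + b) * r + b - 1) (2 * r + 1)"

text \<open>A word of \<open>Q_words r\<close> ends at odd height, one unit to the left of the
  boundary of \<open>(b, a)\<close>. The glued right step lands on that boundary, with excess
  \<open>b - a\<close> relative to \<open>(a, b)\<close>, and \<open>z\<close> then sees the two
  boundaries exchanged.\<close>

lemma glue_excess:
  assumes "w \<in> Q_words r"
  shows "i \<le> length w \<Longrightarrow> excess u v (take i (w @ False # z)) = excess u v (take i w)"
    and "length w < i \<Longrightarrow> excess a b (take i (w @ False # z))
           = b - a + excess b a (take (i - length w - 1) z)"
    and "length w < i \<Longrightarrow> excess b a (take i (w @ False # z))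
           = excess a b (take (i - length w - 1) z)"
    and "excess b a w = - 1"
proof -
  have w: "count_list w False = (a + b) * r + b - 1" "count_list w True = 2 * r + 1"
    using assms by (auto simp: words_under_def words_def)
  have ex: "excess a b (w @ [False]) = b - a" "excess b a (w @ [False]) = 0"
    "excess b a w = - 1"
    using ab by (auto simp: excess_def w stair_def add.commute)
  show "excess b a w = - 1" by (rule ex)
  show "i \<le> length w \<Longrightarrow> excess u v (take i (w @ False # z)) = excess u v (take i w)" by simp
  assume "length w < i"
  hence t: "take i (w @ False # z) = (w @ [False]) @ take (i - length w - 1) z"
    by (auto simp: take_Cons' not_less)
  show "excess a b (take i (w @ False # z)) = b - a + excess b a (take (i - length w - 1) z)"
    "excess b a (take i (w @ False # z)) = excess a b (take (i - length w - 1) z)"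
    unfolding t by (subst excess_append, simp only: ex, simp add: w)+
qed

text \<open>On the second piece the excess \<open>b - a\<close> accumulated at the cut pays for the
  exchange of boundaries. The second claim makes the end of \<open>w\<close> the last violation of
  \<open>(b, a)\<close>, from which the cut can be recovered.\<close>

lemma glue_in:
  assumes r: "r < n" and w: "w \<in> Q_words r" and z: "z \<in> Q_words (n - 1 - r)"
  shows "w @ False # z \<in> P_words a b - P_words b a"
    and "\<And>i. length w < i \<Longrightarrow> i \<le> length (w @ False # z)
           \<Longrightarrow> 0 \<le> excess b a (take i (w @ False # z))"
proof -
  note glue = glue_excess[OF w]
  obtain m where m: "n = r + m + 1" using r by (metis less_imp_Suc_add Suc_eq_plus1)
  have cnt: "w @ False # z \<in> words ((a + b) * n + b - a - 1) (2 * n)"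
    using w z ab by (auto simp: words_under_def words_def m algebra_simps)
  have wpos: "0 \<le> excess a b (take i w)" if "i \<le> length w" for i
    using that w by (auto simp: words_under_def)
  have zpos: "0 \<le> excess a b (take i z)" if "i \<le> length z" for i
    using that z by (auto simp: words_under_def)
  have "0 \<le> excess a b (take i (w @ False # z))" if "i \<le> length (w @ False # z)" for i
  proof (cases "i \<le> length w")
    case True
    thus ?thesis using wpos glue(1) by simp
  next
    case False
    thus ?thesis using glue(2)[of i z] zpos[of "i - length w - 1"] that ab
        excess_swap[of b a "take (i - length w - 1) z"]
      by (auto split: if_splits)
  qed
  hence "w @ False # z \<in> P_words a b" using cnt by (simp add: words_under_def)
  moreover have "w @ False # z \<notin> P_words b a"
    using glue(1)[of "length w" b a z] glue(4) by (auto simp: words_under_def intro!: exI[of _ "length w"])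
  ultimately show "w @ False # z \<in> P_words a b - P_words b a" by blast
  show "0 \<le> excess b a (take i (w @ False # z))"
    if "length w < i" "i \<le> length (w @ False # z)" for i
    using glue(3)[of i z] zpos[of "i - length w - 1"] that by auto
qed

text \<open>The cut is made at the last prefix violating \<open>(b, a)\<close>. Its excess must be
  \<open>- 1\<close> and its height odd, which forces its endpoint to be some \<open>q_r\<close>.
  Beyond the following right step, excess against \<open>(b, a)\<close> is that of the remainder
  against \<open>(a, b)\<close>, so the absence of later violations puts the remainder in the
  required set.\<close>

lemma glue_surj:
  assumes w: "w \<in> P_words a b - P_words b a"
  shows "\<exists>r<n. \<exists>y\<in>Q_words r. \<exists>z\<in>Q_words (n - 1 - r). w = y @ False # z"
proof -
  have counts: "count_list w False = (a + b) * n + b - a - 1" "count_list w True = 2 * n"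
    and pos: "\<And>i. i \<le> length w \<Longrightarrow> 0 \<le> excess a b (take i w)"
    using w by (auto simp: words_under_def words_def)
  define V where "V = {i. i \<le> length w \<and> excess b a (take i w) < 0}"
  obtain k where "k \<le> length w" "\<not> 0 \<le> excess b a (take k w)"
    using w unfolding words_under_def by blast
  hence "V \<noteq> {}" unfolding V_def by auto
  moreover have "finite V" by (simp add: V_def)
  ultimately have "Max V \<in> V" and V_max: "\<And>j. j \<in> V \<Longrightarrow> j \<le> Max V" by auto
  define i where "i = Max V"
  have i: "i \<le> length w" "excess b a (take i w) < 0"
    using \<open>Max V \<in> V\<close> by (auto simp: i_def V_def)
  have later: "0 \<le> excess b a (take j w)" if "i < j" "j \<le> length w" for j
    using V_max[of j] that by (auto simp: i_def V_def not_less[symmetric])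
  \<comment> \<open>The excess of the whole word is \<open>b - a - 1\<close>, so a step follows the
    last violation.\<close>
  have "excess b a w \<ge> 0" using ab by (simp add: excess_def counts stair_def algebra_simps)
  hence il: "i < length w" using i by (cases "i = length w") auto
  define y z where "y = take i w" and "z = drop (Suc i) w"
  have split: "w = y @ w ! i # z" using il by (simp add: y_def z_def id_take_nth_drop)
  have leny: "length y = i" using il by (simp add: y_def)
  have "take (Suc i) w = y @ [w ! i]" using il by (simp add: take_Suc_conv_app_nth y_def)
  hence "excess b a y < 0" "0 \<le> excess b a (y @ [w ! i])"
    using later[of "Suc i"] il i by (auto simp: y_def)
  \<comment> \<open>An up step never raises the excess and a right step raises it by 1, so only a
    right step from \<open>- 1\<close> to \<open>0\<close> can end the violation.\<close>
  hence ey: "excess b a y = - 1" and "\<not> w ! i"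
    by (auto simp: excess_append excess_single split: if_splits)
  hence split': "w = y @ False # z" using split by simp
  \<comment> \<open>The two excesses of \<open>y\<close> differ in sign, whereas at even height they
    would agree.\<close>
  have "odd (count_list y True)"
    using excess_swap[of b a y] pos[of i] ey il by (auto simp: y_def)
  then obtain r where r: "count_list y True = 2 * r + 1" by (elim oddE)
  have yF: "count_list y False = (a + b) * r + b - 1"
  proof -
    have "int (Suc (count_list y False)) = int ((a + b) * r + b)"
      using ey by (simp add: excess_def r stair_def algebra_simps)
    thus ?thesis by linarith
  qed
  have "r < n" using counts(2) by (simp add: split' r)
  then obtain m where m: "n = r + m + 1" by (metis less_imp_Suc_add Suc_eq_plus1)
  have ypos: "0 \<le> excess a b (take j y)" if "j \<le> length y" for j
    using pos[of j] that il leny by (simp add: y_def min_def)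
  have yQ: "y \<in> Q_words r" using r yF ypos by (simp add: words_under_def words_def)
  have "count_list z True = 2 * m + 1" using counts(2) by (simp add: split' r m)
  moreover have "count_list z False = (a + b) * m + b - 1"
    using counts(1) ab by (simp add: split' yF m algebra_simps)
  moreover have "0 \<le> excess a b (take j z)" if "j \<le> length z" for j
    using later[of "Suc i + j"] that glue_excess(3)[OF yQ, of "Suc i + j" z] leny
    by (simp add: split')
  ultimately have "z \<in> Q_words (n - 1 - r)" by (simp add: words_under_def words_def m)
  thus ?thesis using \<open>r < n\<close> yQ split' by blast
qed

text \<open>The length of the first piece is the position of the last violation of
  \<open>(b, a)\<close>, which depends on the glued word alone; the height of that piece then gives
  \<open>r\<close>.\<close>

lemma glue_inj:
  assumes r: "r < n" "w \<in> Q_words r" "z \<in> Q_words (n - 1 - r)"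
    and r': "r' < n" "w' \<in> Q_words r'" "z' \<in> Q_words (n - 1 - r')"
    and eq: "w @ False # z = w' @ False # z'"
  shows "r = r' \<and> w = w' \<and> z = z'"
proof -
  have "length w = length w'"
  proof (rule last_violation_unique[where N = "length (w @ False # z)"])
    show "excess b a (take (length w) (w @ False # z)) < 0"
      using glue_excess(4)[OF r(2)] by simp
    show "excess b a (take (length w') (w @ False # z)) < 0"
      unfolding eq using glue_excess(4)[OF r'(2)] by simp
    show "\<not> excess b a (take k (w @ False # z)) < 0"
      if "length w < k" "k \<le> length (w @ False # z)" for k
      using glue_in(2)[OF r that] by simp
    show "\<not> excess b a (take k (w @ False # z)) < 0"
      if "length w' < k" "k \<le> length (w @ False # z)" for k
      using glue_in(2)[OF r' that(1)] that(2) unfolding eq by simp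
    show "length w' \<le> length (w @ False # z)" unfolding eq by simp
  qed simp
  hence "w = w'" "z = z'" using eq by auto
  moreover have "2 * r + 1 = 2 * r' + 1"
    using r(2) r'(2) \<open>w = w'\<close> by (simp add: words_under_def words_def)
  ultimately show ?thesis by simp
qed

lemma card_P_words_diff:
  "card (P_words a b) = card (P_words b a) + (\<Sum>r<n. card (Q_words r) * card (Q_words (n - 1 - r)))"
proof -
  define D where "D = (SIGMA r:{..<n}. Q_words r \<times> Q_words (n - 1 - r))"
  have "bij_betw (\<lambda>(r, y, z). y @ False # z) D (P_words a b - P_words b a)"
    unfolding bij_betw_def
  proof
    show "inj_on (\<lambda>(r, y, z). y @ False # z) D"
      by (rule inj_onI) (use glue_inj in \<open>auto simp: D_def\<close>)
    show "(\<lambda>(r, y, z). y @ False # z) ` D = P_words a b - P_words b a"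
    proof (intro equalityI subsetI)
      fix w assume "w \<in> (\<lambda>(r, y, z). y @ False # z) ` D"
      thus "w \<in> P_words a b - P_words b a" using glue_in(1) by (auto simp: D_def)
    next
      fix w assume "w \<in> P_words a b - P_words b a"
      from glue_surj[OF this] show "w \<in> (\<lambda>(r, y, z). y @ False # z) ` D"
        by (force simp: D_def)
    qed
  qed
  hence "card (P_words a b - P_words b a) = card D" by (simp add: bij_betw_same_card)
  also have "\<dots> = (\<Sum>r<n. card (Q_words r) * card (Q_words (n - 1 - r)))"
    by (simp add: D_def)
  finally have diff: "card (P_words a b - P_words b a) = \<dots>" .
  \<comment> \<open>At odd heights the boundary of \<open>(a, b)\<close> lies \<open>b - a\<close>
    to the left of that of \<open>(b, a)\<close>, and at even heights they agree.\<close>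
  have "P_words b a \<subseteq> P_words a b"
  proof
    fix w assume w: "w \<in> P_words b a"
    have "0 \<le> excess a b (take i w)" if "i \<le> length w" for i
    proof -
      have "0 \<le> excess b a (take i w)" using w that by (simp add: words_under_def)
      thus ?thesis using excess_swap[of a b "take i w"] ab by (simp split: if_splits)
    qed
    thus "w \<in> P_words a b" using w by (simp add: words_under_def)
  qed
  thus ?thesis using diff card_Diff_subset[of "P_words b a" "P_words a b"]
      card_mono[of "P_words a b" "P_words b a"] by simp
qed

section \<open>Closed forms and the theorem\<close>

lemma card_P_words_sum: "real (card (P_words a b)) + real (card (P_words b a)) = 2 * N_num a b n"
proof -
  define X where "X = (a + b) * n + b - a - 1"
  have X: "Suc X = (a + b) * n + (b - a)" using ab by (simp add: X_def)
  have "(Suc X + 2 * n) * (card (P_words a b) + card (P_words b a))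
      = 2 * (b - a) * ((Suc X + 2 * n) choose (2 * n))"
    unfolding X_def[symmetric]
    by (rule card_words_under_even) (use ab X in \<open>auto simp: stair_def mult.commute\<close>)
  \<comment> \<open>Multiplying by \<open>Suc X\<close> prepares the absorption identity
    \<open>(N - k) * (N choose k) = N * ((N - 1) choose k)\<close> with
    \<open>N = Suc X + 2 * n\<close> and \<open>k = 2 * n\<close>. Cancelling \<open>N\<close>
    leaves the denominator and the binomial coefficient of \<open>N_num\<close>.\<close>
  hence "Suc X * ((Suc X + 2 * n) * (card (P_words a b) + card (P_words b a)))
      = 2 * (b - a) * ((Suc X + 2 * n - 2 * n) * ((Suc X + 2 * n) choose (2 * n)))"
    by (simp only: mult_ac diff_add_inverse2)
  also have "(Suc X + 2 * n - 2 * n) * ((Suc X + 2 * n) choose (2 * n))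
      = (Suc X + 2 * n) * ((Suc X + 2 * n - 1) choose (2 * n))"
    by (rule binomial_absorb_comp)
  finally have "(Suc X + 2 * n) * (Suc X * (card (P_words a b) + card (P_words b a)))
      = (Suc X + 2 * n) * (2 * (b - a) * ((X + 2 * n) choose (2 * n)))"
    by (simp only: mult_ac) simp
  hence "Suc X * (card (P_words a b) + card (P_words b a)) = 2 * (b - a) * ((X + 2 * n) choose (2 * n))"
    by (simp only: mult_cancel1) simp
  hence "real (Suc X) * (real (card (P_words a b)) + real (card (P_words b a)))
      = 2 * real (b - a) * real ((X + 2 * n) choose (2 * n))"
    by (metis of_nat_add of_nat_mult of_nat_numeral)
  hence "real (card (P_words a b)) + real (card (P_words b a))
      = 2 * (real (b - a) / real (Suc X) * real ((X + 2 * n) choose (2 * n)))"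
    by (simp add: field_simps del: of_nat_Suc)
  moreover have "X + 2 * n = (a + b + 2) * n + b - a - 1"
    using ab by (simp add: X_def algebra_simps)
  moreover have "real (Suc X) = real (a + b) * real n + real b - real a"
    unfolding X using ab by (simp add: of_nat_diff algebra_simps)
  ultimately show ?thesis
    using ab by (simp only: N_num_def of_nat_diff less_imp_le)
qed

end

text \<open>The odd count applies because \<open>Suc X = stair b a Y\<close>; absorption then moves
  the denominator from \<open>Suc X + Y\<close> to \<open>Suc X\<close>.\<close>

lemma card_Q_words:
  assumes "a < b"
  shows "real (card (Q_words a b n)) = M_num a b n"
proof -
  define X where "X = (a + b) * n + b - 1"
  define Y where "Y = 2 * n + 1"
  have X: "Suc X = (a + b) * n + b" using assms by (simp add: X_def)
  have "(Suc X + Y) * card (Q_words a b n) = (b - a) * ((Suc X + Y) choose Y)"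
    unfolding X_def[symmetric] Y_def[symmetric]
    by (rule card_words_under_odd) (use assms X in \<open>auto simp: stair_def Y_def add.commute\<close>)
  hence "Suc X * ((Suc X + Y) * card (Q_words a b n))
      = (b - a) * ((Suc X + Y - Y) * ((Suc X + Y) choose Y))"
    by (simp only: mult_ac diff_add_inverse2)
  also have "(Suc X + Y - Y) * ((Suc X + Y) choose Y) = (Suc X + Y) * ((Suc X + Y - 1) choose Y)"
    by (rule binomial_absorb_comp)
  finally have "(Suc X + Y) * (Suc X * card (Q_words a b n))
      = (Suc X + Y) * ((b - a) * ((X + Y) choose Y))"
    by (simp only: mult_ac) simp
  hence "Suc X * card (Q_words a b n) = (b - a) * ((X + Y) choose Y)"
    by (simp only: mult_cancel1) simp
  hence "real (Suc X) * real (card (Q_words a b n)) = real (b - a) * real ((X + Y) choose Y)"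
    by (metis of_nat_mult)
  hence "real (card (Q_words a b n)) = real (b - a) / real (Suc X) * real ((X + Y) choose Y)"
    by (simp add: field_simps del: of_nat_Suc)
  moreover have "X + Y = (a + b + 2) * n + b"
    using assms by (simp add: X_def Y_def algebra_simps)
  moreover have "real (Suc X) = real (a + b) * real n + real b"
    unfolding X by simp
  ultimately show ?thesis
    using assms by (simp only: M_num_def Y_def[symmetric] of_nat_diff less_imp_le)
qed

theorem theorem4:
  fixes a b n :: nat
  assumes "a < b"
  shows "real (card (paths_under a b (q_point a b n))) = M_num a b n
    \<and> card (paths_under b a (q_point a b n)) = 0
    \<and> real (card (paths_under a b (p_point a b n)))
        = N_num a b n + 1 / 2 * (\<Sum>i<n. M_num a b i * M_num a b (n - 1 - i))
    \<and> real (card (paths_under b a (p_point a b n)))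
        = N_num a b n - 1 / 2 * (\<Sum>i<n. M_num a b i * M_num a b (n - 1 - i))"
proof -
  have p: "p_point a b n = (int ((a + b) * n + b - a - 1), int (2 * n))"
    using assms by (simp add: p_point_def of_nat_diff algebra_simps)
  have q: "q_point a b n = (int ((a + b) * n + b - 1), int (2 * n + 1))"
    using assms by (simp add: q_point_def of_nat_diff algebra_simps)
  \<comment> \<open>The endpoint \<open>q_n\<close> itself lies one unit to the left of the boundary
    of \<open>(b, a)\<close>.\<close>
  have "words_under b a ((a + b) * n + b - 1) (2 * n + 1) = {}"
  proof -
    have "excess b a (take (length w) w) < 0" if "w \<in> words ((a + b) * n + b - 1) (2 * n + 1)" for w
      using that assms by (auto simp: words_def excess_def stair_def add.commute)
    thus ?thesis by (force simp: words_under_def)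
  qed
  moreover have "real (card (P_words a b n a b)) = real (card (P_words a b n b a))
      + (\<Sum>i<n. M_num a b i * M_num a b (n - 1 - i))"
    unfolding card_P_words_diff[OF assms, of n]
    by (simp only: card_Q_words[OF assms, symmetric] of_nat_add of_nat_sum of_nat_mult)
  \<comment> \<open>The two counts for \<open>p_n\<close> have sum \<open>2 * N_num a b n\<close>
    and known difference; solving this linear system produces the factor
    \<open>1 / 2\<close>.\<close>
  ultimately show ?thesis
    using card_P_words_sum[OF assms, of n] card_Q_words[OF assms, of n]
    unfolding p q card_paths_under by simp
qed

end
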